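(* Let $m\in\mathbb{N}$. For every finite coloring of $\mathbb{N}$ there are an infinite set $A\subseteq\mathbb{N}$ and a set $B\subseteq\mathbb{N}$ with exactly $m$ elements such that $(A+B)\cup(AB)$ is monochromatic.
   Context: $\mathbb{N}=\{1,2,3,\dots\}$. For $A,B\subseteq\mathbb{N}$, $A+B=\{a+b:a\in A,b\in B\}$ and $AB=\{ab:a\in A,b\in B\}$. A set is monochromatic if all its elements have the same color. *)

theory Defs
  imports Complex_Main "HOL-Library.Set_Algebras"
begin

text \<open>Here the natural numbers start at 1, so colorings are only considered on
  the set \<open>{1..}\<close> of positive elements of \<^typ>\<open>nat\<close>.  The sumset and the product set
  are the operations \<open>+\<close> and \<open>*\<close> on sets from Set_Algebras.\<close>

definition finite_coloring :: "(nat \<Rightarrow> 'c) \<Rightarrow> bool" where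
  "finite_coloring c \<longleftrightarrow> finite (c ` {1..})"

definition monochromatic :: "(nat \<Rightarrow> 'c) \<Rightarrow> nat set \<Rightarrow> bool" where
  "monochromatic c S \<longleftrightarrow> (\<forall>x\<in>S. \<forall>y\<in>S. c x = c y)"

end

theory Submission
  imports Defs
begin

text \<open>
  Following Moreira, build piecewise syndetic monochromatic sets \<open>B\<^sub>0, B\<^sub>1, \<dots>\<close> and integers
  \<open>y\<^sub>n \<ge> 2\<close> such that every element of \<open>B\<^bsub>n+1\<^esub>\<close> is \<open>y\<^sub>n x\<close> with \<open>x + f y\<^sub>n \<in> B\<^sub>n\<close> for all \<open>f\<close> up
  to \<open>P\<^sub>n\<^sup>2\<close>, where \<open>P\<^sub>n = y\<^sub>0 \<cdots> y\<^bsub>n-1\<^esub>\<close>; van der Waerden's theorem provides \<open>y\<^sub>n\<close>. Infinitely many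
  \<open>B\<^sub>n\<close> have the same color. Let \<open>i < k\<^sub>1 < \<dots> < k\<^sub>m\<close> be such indices and \<open>q\<^sub>j = P\<^bsub>k\<^sub>j\<^esub> / P\<^sub>i\<close>. An element
  \<open>q\<^sub>m x\<close> of the last set descends to \<open>q\<^sub>j x \<in> B\<^bsub>k\<^sub>j\<^esub>\<close> for every \<open>j\<close>, and each of these memberships
  forces \<open>x + q\<^sub>j \<in> B\<^sub>i\<close>. So \<open>B = {q\<^sub>1, \<dots>, q\<^sub>m}\<close> works, with \<open>A\<close> the set of all such \<open>x\<close>.
\<close>

section \<open>Van der Waerden's theorem\<close>

text \<open>
  Color focusing: the progressions \<open>f + d, f + 2d, \<dots>, f + kd\<close> with \<open>d\<close> in the list are
  monochromatic of pairwise different colors and share the focus \<open>f\<close>.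
\<close>

lemma color_focusing:
  fixes k r s :: nat
  assumes "k \<ge> 1"
    and vdW: "\<And>r. \<exists>W. \<forall>c::nat\<Rightarrow>nat. (\<forall>n. c n < r) \<longrightarrow>
           (\<exists>a d. 1 \<le> d \<and> a + k * d < W \<and> (\<forall>j<k. c (a + j * d) = c a))"
  shows "\<exists>W. \<forall>c::nat\<Rightarrow>nat. (\<forall>n. c n < r) \<longrightarrow>
           (\<exists>a d. 1 \<le> d \<and> a + Suc k * d < W \<and> (\<forall>j<Suc k. c (a + j * d) = c a)) \<or>
           (\<exists>f ds. f < W \<and> length ds = s \<and> distinct (map (\<lambda>d. c (f + d)) ds) \<and>
              (\<forall>d\<in>set ds. 1 \<le> d \<and> f + Suc k * d < W \<and> (\<forall>j\<in>{1..k}. c (f + j * d) = c (f + d))))"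
proof (induction s)
  case 0
  have "\<exists>f ds. f < (1::nat) \<and> length (ds::nat list) = 0" by auto
  then show ?case by (intro exI[of _ 1]) auto
next
  case (Suc s)
  then obtain W where W: "\<And>c::nat\<Rightarrow>nat. \<forall>n. c n < r \<Longrightarrow>
           (\<exists>a d. 1 \<le> d \<and> a + Suc k * d < W \<and> (\<forall>j<Suc k. c (a + j * d) = c a)) \<or>
           (\<exists>f ds. f < W \<and> length ds = s \<and> distinct (map (\<lambda>d. c (f + d)) ds) \<and>
              (\<forall>d\<in>set ds. 1 \<le> d \<and> f + Suc k * d < W \<and> (\<forall>j\<in>{1..k}. c (f + j * d) = c (f + d))))"
    by blast
  \<comment> \<open>A word of \<open>W\<close> colors counts as a single color, so that
    \<open>vdW\<close> for \<open>k\<close> terms applies to a coloring by words.\<close>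
  define blocks where "blocks = {xs. set xs \<subseteq> {..<r} \<and> length xs = W}"
  have "finite blocks" unfolding blocks_def by (rule finite_lists_length_eq) simp
  then obtain enc where enc: "bij_betw enc blocks {0..<card blocks}"
    using ex_bij_betw_finite_nat by blast
  obtain V where V: "\<And>c::nat\<Rightarrow>nat. \<forall>n. c n < card blocks \<Longrightarrow>
           \<exists>a d. 1 \<le> d \<and> a + k * d < V \<and> (\<forall>j<k. c (a + j * d) = c a)"
    using vdW[of "card blocks"] by blast
  show ?case
  \<comment> \<open>Blocks start at \<open>V\<close> or later, which leaves room to go back one step
    \<open>D\<close>; their starts stay below \<open>2 * V\<close>, and the last block adds
    \<open>W\<close>.\<close>
  proof (rule exI[of _ "2 * V + W"], intro allI impI)
    fix c :: "nat \<Rightarrow> nat"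
    assume c: "\<forall>n. c n < r"
    define block where "block n = map (\<lambda>i. c (n + i)) [0..<W]" for n
    have block: "block n \<in> blocks" for n
      using c by (auto simp: block_def blocks_def)
    obtain a D where D: "1 \<le> D" "a + k * D < V"
      and eq: "\<And>j. j < k \<Longrightarrow> enc (block (V + (a + j * D))) = enc (block (V + a))"
      using V[of "\<lambda>n. enc (block (V + n))"] enc block by (force simp: bij_betw_def)
    have block_eq: "block (V + (a + j * D)) = block (V + a)" if "j < k" for j
      using eq[OF that] enc block by (auto simp: bij_betw_def inj_on_def)
    have "D \<le> k * D" using assms(1) by simp
    then have "D \<le> V" using D by linarith
    \<comment> \<open>One step before the block progression: the blocks at \<open>b + D\<close>,
      ..., \<open>b + k * D\<close> agree, while nothing is known about the block at
      \<open>b\<close>, where the new focus will lie.\<close>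
    define b where "b = V + a - D"
    have bD: "V + a = b + D" using \<open>D \<le> V\<close> by (simp add: b_def)
    have shift: "c (b + j * D + i) = c (b + D + i)" if "1 \<le> j" "j \<le> k" "i < W" for i j
    proof -
      have "block (V + (a + (j - 1) * D)) ! i = block (V + a) ! i"
        using block_eq[of "j - 1"] that by simp
      moreover have "V + (a + (j - 1) * D) = b + j * D"
        using bD that by (cases j) (auto simp: algebra_simps)
      ultimately show ?thesis using that bD by (simp add: block_def)
    qed
    have bound: "b + Suc k * D + i < 2 * V + W" if "i < W" for i
      using bD D that by simp
    from W[of "\<lambda>n. c (b + D + n)"] c
    consider (ap) a' d where "1 \<le> d" "a' + Suc k * d < W"
        "\<forall>j<Suc k. c (b + D + (a' + j * d)) = c (b + D + a')"
      | (foc) f ds where "f < W" "length ds = s" "distinct (map (\<lambda>d. c (b + D + (f + d))) ds)"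
         "\<forall>d\<in>set ds. 1 \<le> d \<and> f + Suc k * d < W \<and>
            (\<forall>j\<in>{1..k}. c (b + D + (f + j * d)) = c (b + D + (f + d)))"
      by blast
    then show "(\<exists>a d. 1 \<le> d \<and> a + Suc k * d < 2 * V + W \<and> (\<forall>j<Suc k. c (a + j * d) = c a)) \<or>
           (\<exists>f ds. f < 2 * V + W \<and> length ds = Suc s \<and> distinct (map (\<lambda>d. c (f + d)) ds) \<and>
              (\<forall>d\<in>set ds. 1 \<le> d \<and> f + Suc k * d < 2 * V + W \<and>
                 (\<forall>j\<in>{1..k}. c (f + j * d) = c (f + d))))"
      (is "?AP \<or> ?FOC")
    proof cases
      case ap
      have "(b + D + a') + Suc k * d < 2 * V + W"
        using bound[OF ap(2)] by simp
      then have ?AP using ap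
        by (intro exI[of _ "b + D + a'"] exI[of _ d]) (simp add: add.assoc)
      then show ?thesis ..
    next
      case foc
      show ?thesis
      \<comment> \<open>If the focus shares the color of one of its progressions, it completes that
        one to \<open>k + 1\<close> terms; otherwise its color is new.\<close>
      proof (cases "\<exists>d\<in>set ds. c (b + D + (f + d)) = c (b + D + f)")
        case True
        then obtain d where d: "d \<in> set ds" "c (b + D + (f + d)) = c (b + D + f)" by blast
        have "c (b + D + (f + j * d)) = c (b + D + f)" if "j < Suc k" for j
          using foc(4) d that by (cases "j = 0") auto
        moreover have "(b + D + f) + Suc k * d < 2 * V + W"
          using bound[of "f + Suc k * d"] foc(4) d by simp
        ultimately have ?AP using foc(4) d
          by (intro exI[of _ "b + D + f"] exI[of _ d]) (simp add: add.assoc)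
        then show ?thesis ..
      next
        case False
        \<comment> \<open>The focus moves back by \<open>D\<close>. Copies of the old focus in the
          equal blocks form a progression with difference \<open>D\<close> in the new color; the old
          progressions get difference \<open>D + d\<close>, advancing one block and \<open>d\<close>
          inside it at once.\<close>
        define F where "F = b + f"
        define ds' where "ds' = D # map (\<lambda>d. D + d) ds"
        have col: "c (F + j * (D + d)) = c (F + (D + d))"
          if "d \<in> set ds" "j \<in> {1..k}" for d j
        proof -
          have "j * d \<le> Suc k * d" "d \<le> Suc k * d" using that by (auto intro: mult_le_mono1 trans_le_add2)
          then have lt: "f + j * d < W" "f + d < W" using foc(4) that
            by (meson add_left_mono le_less_trans)+
          have "F + j * (D + d) = b + j * D + (f + j * d)" by (simp add: F_def algebra_simps)
          then have "c (F + j * (D + d)) = c (b + D + (f + j * d))"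
            using shift[of j "f + j * d"] lt that by simp
          also have "\<dots> = c (b + D + (f + d))" using foc(4) that by blast
          finally show ?thesis by (simp add: F_def algebra_simps)
        qed
        have colD: "c (F + j * D) = c (F + D)" if "j \<in> {1..k}" for j
          using shift[of j f] that foc(1) by (simp add: F_def algebra_simps)
        have bd: "F + Suc k * (D + d) < 2 * V + W" if "d \<in> set ds" for d
          using bound[of "f + Suc k * d"] foc(4) that by (simp add: F_def algebra_simps)
        have bdD: "F + Suc k * D < 2 * V + W"
          using bound[OF foc(1)] by (simp add: F_def algebra_simps)
        have "distinct (map (\<lambda>d. c (F + d)) ds')"
          using foc(3) False by (auto simp: ds'_def F_def comp_def algebra_simps)
        moreover have "length ds' = Suc s" using foc(2) by (simp add: ds'_def)
        moreover have "\<forall>d\<in>set ds'. 1 \<le> d \<and> F + Suc k * d < 2 * V + W \<and>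
                 (\<forall>j\<in>{1..k}. c (F + j * d) = c (F + d))"
          using col colD bd bdD D(1) unfolding ds'_def by auto
        moreover have "F < 2 * V + W" using bdD by simp
        ultimately have ?FOC by blast
        then show ?thesis ..
      qed
    qed
  qed
qed

text \<open>The colors of \<open>r\<close> focused progressions exhaust all \<open>r\<close> colors,
  so the focus prolongs one of them. Bounding \<open>a + k * d\<close> rather than the last term
  also bounds \<open>d\<close> once \<open>k \<ge> 1\<close>; color focusing and the return argument
  both use this.\<close>

theorem van_der_Waerden:
  "\<exists>W. \<forall>c::nat\<Rightarrow>nat. (\<forall>n. c n < r) \<longrightarrow>
     (\<exists>a d. 1 \<le> d \<and> a + k * d < W \<and> (\<forall>j<k. c (a + j * d) = c a))"
proof (induction k arbitrary: r)
  case 0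
  show ?case by (intro exI[of _ 1]) auto
next
  case (Suc k)
  show ?case
  proof (cases "k = 0")
    case True
    have "1 \<le> (1::nat) \<and> 0 + Suc 0 * 1 < (2::nat) \<and> (\<forall>j<Suc 0. c (0 + j * 1) = c 0)"
      for c :: "nat \<Rightarrow> nat" by simp
    then show ?thesis unfolding True by blast
  next
    case False
    then have "k \<ge> 1" by simp
    from color_focusing[OF this Suc.IH, of r r]
    obtain W where W: "\<And>c::nat\<Rightarrow>nat. \<forall>n. c n < r \<Longrightarrow>
           (\<exists>a d. 1 \<le> d \<and> a + Suc k * d < W \<and> (\<forall>j<Suc k. c (a + j * d) = c a)) \<or>
           (\<exists>f ds. f < W \<and> length ds = r \<and> distinct (map (\<lambda>d. c (f + d)) ds) \<and>
              (\<forall>d\<in>set ds. 1 \<le> d \<and> f + Suc k * d < W \<and> (\<forall>j\<in>{1..k}. c (f + j * d) = c (f + d))))"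
      by blast
    show ?thesis
    proof (rule exI[of _ W], intro allI impI)
      fix c :: "nat \<Rightarrow> nat"
      assume c: "\<forall>n. c n < r"
      show "\<exists>a d. 1 \<le> d \<and> a + Suc k * d < W \<and> (\<forall>j<Suc k. c (a + j * d) = c a)"
        using W[OF c]
      proof
        assume "\<exists>f ds. f < W \<and> length ds = r \<and> distinct (map (\<lambda>d. c (f + d)) ds) \<and>
              (\<forall>d\<in>set ds. 1 \<le> d \<and> f + Suc k * d < W \<and> (\<forall>j\<in>{1..k}. c (f + j * d) = c (f + d)))"
        then obtain f ds where ds: "length ds = r" "distinct (map (\<lambda>d. c (f + d)) ds)"
          "\<And>d. d \<in> set ds \<Longrightarrow> 1 \<le> d \<and> f + Suc k * d < W \<and> (\<forall>j\<in>{1..k}. c (f + j * d) = c (f + d))"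
          by blast
        let ?C = "set (map (\<lambda>d. c (f + d)) ds)"
        have "card ?C = r" using distinct_card[OF ds(2)] ds(1) by simp
        moreover have "?C \<subseteq> {..<r}" using c by auto
        ultimately have "?C = {..<r}" by (simp add: card_subset_eq)
        with c have "c f \<in> ?C" by blast
        then obtain d where d: "d \<in> set ds" "c (f + d) = c f" by auto
        have "c (f + j * d) = c f" if "j < Suc k" for j
          using ds(3)[OF d(1)] d(2) that by (cases "j = 0") auto
        then show ?thesis using ds(3)[OF d(1)] by blast
      qed
    qed
  qed
qed

section \<open>Piecewise syndetic sets\<close>

definition piecewise_syndetic :: "nat set \<Rightarrow> bool" where
  "piecewise_syndetic A \<longleftrightarrow> (\<exists>L. \<forall>N. \<exists>x. \<forall>n\<in>{x..<x + N}. \<exists>f<L. n + f \<in> A)"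

text \<open>Partition regularity: where \<open>B\<close> leaves a gap of length
  \<open>M + L\<close>, the windows of length \<open>L\<close> starting at its first
  \<open>M\<close> points can only be met by \<open>A\<close>.\<close>

lemma piecewise_syndetic_Un:
  assumes "piecewise_syndetic (A \<union> B)"
  shows "piecewise_syndetic A \<or> piecewise_syndetic B"
proof (rule disjCI)
  assume B: "\<not> piecewise_syndetic B"
  obtain L where L: "\<And>N. \<exists>x. \<forall>n\<in>{x..<x + N}. \<exists>f<L. n + f \<in> A \<union> B"
    using assms unfolding piecewise_syndetic_def by blast
  show "piecewise_syndetic A"
    unfolding piecewise_syndetic_def
  proof (rule exI[of _ L], intro allI)
    fix M
    obtain N where N: "\<And>x. \<exists>n\<in>{x..<x + N}. \<forall>f<M + L. n + f \<notin> B"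
      using B unfolding piecewise_syndetic_def by metis
    obtain x where x: "\<forall>n\<in>{x..<x + (N + M)}. \<exists>f<L. n + f \<in> A \<union> B"
      using L by blast
    obtain n where n: "n \<in> {x..<x + N}" "\<forall>f<M + L. n + f \<notin> B" using N by blast
    have "\<exists>f<L. n' + f \<in> A" if n': "n' \<in> {n..<n + M}" for n'
    proof -
      have "n' \<in> {x..<x + (N + M)}" using n(1) n' by auto
      then obtain f where f: "f < L" "n' + f \<in> A \<union> B" using x by blast
      have "n' + f = n + (n' - n + f)" "n' - n + f < M + L" using n' f by auto
      then have "n' + f \<notin> B" using n(2) by metis
      with f show ?thesis by blast
    qed
    then show "\<exists>x. \<forall>n\<in>{x..<x + M}. \<exists>f<L. n + f \<in> A" by blast
  qed
qed

lemma piecewise_syndetic_mono: "piecewise_syndetic A \<Longrightarrow> A \<subseteq> B \<Longrightarrow> piecewise_syndetic B"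
  unfolding piecewise_syndetic_def by (meson subsetD)

lemma not_piecewise_syndetic_empty: "\<not> piecewise_syndetic {}"
proof
  assume "piecewise_syndetic {}"
  then obtain x :: nat where "\<forall>n\<in>{x..<x + 1}. False"
    unfolding piecewise_syndetic_def by fastforce
  then show False by simp
qed

lemma piecewise_syndetic_UN:
  assumes "finite I" "piecewise_syndetic (\<Union>i\<in>I. A i)"
  shows "\<exists>i\<in>I. piecewise_syndetic (A i)"
  using assms
  by (induction I rule: finite_induct)
     (auto simp: not_piecewise_syndetic_empty dest: piecewise_syndetic_Un)

lemma piecewise_syndetic_imp_infinite:
  assumes "piecewise_syndetic A"
  shows "infinite A"
proof
  assume "finite A"
  then obtain M where M: "\<forall>a\<in>A. a < M" using finite_nat_set_iff_bounded by blast
  obtain x L where "\<forall>n\<in>{x..<x + Suc M}. \<exists>f<L. n + f \<in> A"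
    using assms unfolding piecewise_syndetic_def by blast
  then obtain f where "x + M + f \<in> A" by fastforce
  with M show False by fastforce
qed

lemma piecewise_syndetic_dilation:
  assumes "piecewise_syndetic A" "y \<ge> 1"
  shows "piecewise_syndetic ((*) y ` A)"
proof -
  obtain L where L: "\<And>N. \<exists>x. \<forall>n\<in>{x..<x + N}. \<exists>f<L. n + f \<in> A"
    using assms unfolding piecewise_syndetic_def by blast
  show ?thesis
    unfolding piecewise_syndetic_def
  proof (rule exI[of _ "y * L + 1"], intro allI)
    fix N
    obtain x where x: "\<forall>n\<in>{x..<x + (N + 2)}. \<exists>f<L. n + f \<in> A" using L by blast
    have "\<exists>f<y * L + 1. n + f \<in> (*) y ` A" if n: "n \<in> {y * x..<y * x + N}" for n
    proof -
      have "x \<le> n div y" using n assms(2) by (simp add: less_eq_div_iff_mult_less_eq mult.commute)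
      moreover have "n div y \<le> x + N"
      proof -
        have "N \<le> y * N" using assms(2) by simp
        moreover have "n < y * x + N" using n by simp
        ultimately have "n \<le> y * (x + N)" unfolding add_mult_distrib2 by linarith
        then show ?thesis using assms(2) by (metis div_le_mono div_mult_self1_is_m less_le_trans zero_less_one)
      qed
      \<comment> \<open>Rounding up makes the multiple of \<open>y\<close> exceed \<open>n\<close>;
        the rounded quotient can reach \<open>x + N + 1\<close>, hence the length
        \<open>N + 2\<close>.\<close>
      ultimately have "n div y + 1 \<in> {x..<x + (N + 2)}" by simp
      then obtain f where f: "f < L" "n div y + 1 + f \<in> A" using x by blast
      let ?g = "(y - n mod y) + y * f"
      have "n mod y < y" using assms(2) by simp
      moreover have "y * (n div y + 1 + f) = y * (n div y) + y + y * f" by (simp add: algebra_simps)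
      ultimately have eq: "n + ?g = y * (n div y + 1 + f)"
        using mult_div_mod_eq[of y n] by linarith
      have "y * Suc f \<le> y * L" using f(1) by (intro mult_le_mono2) simp
      then have "?g < y * L + 1" by (simp add: algebra_simps)
      with eq f(2) show ?thesis by (metis image_eqI)
    qed
    then show "\<exists>x. \<forall>n\<in>{x..<x + N}. \<exists>f<y * L + 1. n + f \<in> (*) y ` A" by blast
  qed
qed

text \<open>Color \<open>i\<close> by an offset from \<open>n + i\<close> to a point of
  \<open>A\<close>: there are \<open>L\<close> colors, and a monochromatic progression of indices is
  translated into one inside \<open>A\<close> with difference below \<open>W\<close>. The union over
  these finitely many differences is piecewise syndetic, and partition regularity selects one. The
  bound \<open>y \<ge> 2\<close> later makes \<open>P\<close> strictly increasing.\<close>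

lemma piecewise_syndetic_returns:
  assumes "piecewise_syndetic A"
  shows "\<exists>y\<ge>2. piecewise_syndetic {x \<in> A. \<forall>f\<le>M. x + f * y \<in> A}"
proof -
  obtain L where L: "\<And>N. \<exists>x. \<forall>n\<in>{x..<x + N}. \<exists>f<L. n + f \<in> A"
    using assms unfolding piecewise_syndetic_def by blast
  have "L > 0" using L[of 1] by auto
  \<comment> \<open>The final difference is \<open>2 * d\<close>, which ensures
    \<open>y \<ge> 2\<close>, so multiples of \<open>d\<close> up to \<open>2 * M\<close> are
    needed.\<close>
  define k where "k = Suc (2 * M)"
  obtain W where W: "\<And>c::nat\<Rightarrow>nat. \<forall>n. c n < L \<Longrightarrow>
     \<exists>a d. 1 \<le> d \<and> a + k * d < W \<and> (\<forall>j<k. c (a + j * d) = c a)"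
    using van_der_Waerden[of L k] by blast
  define R where "R d = {x \<in> A. \<forall>j<k. x + j * d \<in> A}" for d
  have "piecewise_syndetic (\<Union>d\<in>{1..<W}. R d)"
    unfolding piecewise_syndetic_def
  proof (rule exI[of _ "W + L"], intro allI)
    fix N
    obtain x where x: "\<forall>n\<in>{x..<x + (N + W)}. \<exists>f<L. n + f \<in> A" using L by blast
    have "\<exists>f<W + L. n + f \<in> (\<Union>d\<in>{1..<W}. R d)" if n: "n \<in> {x..<x + N}" for n
    proof -
      \<comment> \<open>The coloring must be total: from \<open>W\<close> on, any value below
        \<open>L\<close> serves.\<close>
      have "\<forall>i. \<exists>f<L. i < W \<longrightarrow> n + i + f \<in> A"
      proof
        fix i
        show "\<exists>f<L. i < W \<longrightarrow> n + i + f \<in> A"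
        proof (cases "i < W")
          case True
          then have "n + i \<in> {x..<x + (N + W)}" using n by simp
          with x show ?thesis by blast
        qed (use \<open>L > 0\<close> in blast)
      qed
      then obtain c where c: "\<forall>i. c i < L" "\<And>i. i < W \<Longrightarrow> n + i + c i \<in> A" by metis
      obtain a d where d: "1 \<le> d" "a + k * d < W" "\<And>j. j < k \<Longrightarrow> c (a + j * d) = c a"
        using W[OF c(1)] by blast
      have mem: "n + (a + c a) + j * d \<in> A" if "j < k" for j
      proof -
        have "j * d \<le> k * d" using that by simp
        then have "a + j * d < W" using d(2) by linarith
        from c(2)[OF this] d(3)[OF that] show ?thesis by (simp add: add_ac)
      qed
      have "n + (a + c a) \<in> R d" using mem mem[of 0] by (simp add: R_def k_def)
      moreover have "d < W" using d(2) by (simp add: k_def)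
      moreover have "a + c a < W + L" using c(1) d(2) by (simp add: add_strict_mono)
      ultimately show ?thesis using d(1) by (intro exI[of _ "a + c a"]) auto
    qed
    then show "\<exists>x. \<forall>n\<in>{x..<x + N}. \<exists>f<W + L. n + f \<in> (\<Union>d\<in>{1..<W}. R d)" by blast
  qed
  then obtain d where d: "d \<in> {1..<W}" "piecewise_syndetic (R d)"
    using piecewise_syndetic_UN[of "{1..<W}" R] by auto
  have "R d \<subseteq> {x \<in> A. \<forall>f\<le>M. x + f * (2 * d) \<in> A}"
  proof
    fix x assume x: "x \<in> R d"
    have "x + f * (2 * d) \<in> A" if "f \<le> M" for f
    proof -
      have "x + (2 * f) * d \<in> A" using x that by (simp add: R_def k_def)
      then show ?thesis by (simp add: algebra_simps)
    qed
    then show "x \<in> {x \<in> A. \<forall>f\<le>M. x + f * (2 * d) \<in> A}" using x by (simp add: R_def)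
  qed
  with d(2) have "piecewise_syndetic {x \<in> A. \<forall>f\<le>M. x + f * (2 * d) \<in> A}"
    using piecewise_syndetic_mono by blast
  with d(1) show ?thesis by (intro exI[of _ "2 * d"]) auto
qed

lemma piecewise_syndetic_color:
  assumes "finite_coloring c" "piecewise_syndetic A" "A \<subseteq> {1..}"
  shows "\<exists>t\<in>c ` {1..}. piecewise_syndetic {x \<in> A. c x = t}"
proof -
  have "A = (\<Union>t\<in>c ` {1..}. {x \<in> A. c x = t})" using assms(3) by auto
  then show ?thesis
    using assms piecewise_syndetic_UN[of "c ` {1..}" "\<lambda>t. {x \<in> A. c x = t}"]
    by (simp add: finite_coloring_def)
qed

section \<open>The nested monochromatic sets\<close>

text \<open>Return sets, dilation and restriction to a suitable color class preserve piecewise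
  syndeticity, so dependent choice applies. The bound \<open>(P n)\<^sup>2\<close> covers
  \<open>q\<^sup>2\<close> for every quotient \<open>q = P n div P i\<close> with
  \<open>i \<le> n\<close>: descending to level \<open>i\<close> divides the shift
  \<open>q\<^sup>2 * y\<close> by \<open>q\<close>.\<close>

lemma nested_sequence_exists:
  assumes "finite_coloring c"
  obtains S :: "nat \<Rightarrow> nat set" and P :: "nat \<Rightarrow> nat" and t
  where "\<And>n. piecewise_syndetic (S n)" "\<And>n. S n \<subseteq> {1..}" "\<And>n. P n \<ge> 1"
    "\<And>n. t n \<in> c ` {1..}" "\<And>n x. x \<in> S n \<Longrightarrow> c x = t n"
    "\<And>n. \<exists>y\<ge>2. P (Suc n) = y * P n \<and>
        S (Suc n) \<subseteq> (*) y ` {x \<in> S n. \<forall>f\<le>(P n)\<^sup>2. x + f * y \<in> S n}"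
proof -
  define good where "good = (\<lambda>(S, P, t). piecewise_syndetic S \<and> S \<subseteq> {1..} \<and> (P::nat) \<ge> 1 \<and>
      t \<in> c ` {1..} \<and> (\<forall>x\<in>S. c x = t))"
  define step where "step = (\<lambda>(S :: nat set, P :: nat, t::'a) (S', P', t'::'a). \<exists>y\<ge>2. P' = y * P \<and>
      S' \<subseteq> (*) y ` {x \<in> S. \<forall>f\<le>P\<^sup>2. x + f * y \<in> S})"
  have "\<exists>s. \<forall>n. good (s n) \<and> step (s n) (s (Suc n))"
  proof (rule dependent_nat_choice)
    have "piecewise_syndetic {1..}"
      unfolding piecewise_syndetic_def by (intro exI[of _ 1] allI) auto
    then obtain t where "t \<in> c ` {1..}" "piecewise_syndetic {x \<in> {1..}. c x = t}"
      using piecewise_syndetic_color[OF assms] by blast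
    then have "good ({x \<in> {1..}. c x = t}, 1, t)" by (auto simp: good_def)
    then show "\<exists>s. good s" ..
  next
    fix s n assume "good s"
    obtain S P t where s: "s = (S, P, t)" by (cases s)
    have S: "piecewise_syndetic S" "S \<subseteq> {1..}" "P \<ge> 1"
      using \<open>good s\<close> by (auto simp: good_def s)
    obtain y where y: "y \<ge> 2" "piecewise_syndetic {x \<in> S. \<forall>f\<le>P\<^sup>2. x + f * y \<in> S}"
      using piecewise_syndetic_returns[OF S(1)] by blast
    let ?D = "(*) y ` {x \<in> S. \<forall>f\<le>P\<^sup>2. x + f * y \<in> S}"
    have "piecewise_syndetic ?D" using piecewise_syndetic_dilation[OF y(2)] y(1) by simp
    moreover have D1: "?D \<subseteq> {1..}" using S(2) y(1) by auto
    ultimately obtain t' where t': "t' \<in> c ` {1..}" "piecewise_syndetic {x \<in> ?D. c x = t'}"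
      using piecewise_syndetic_color[OF assms] by blast
    have "good ({x \<in> ?D. c x = t'}, y * P, t')"
      using t' D1 y(1) S(3) by (auto simp: good_def)
    moreover have "step s ({x \<in> ?D. c x = t'}, y * P, t')"
      using y(1) by (auto simp: step_def s)
    ultimately show "\<exists>s'. good s' \<and> step s s'" by blast
  qed
  then obtain s where s: "\<And>n. good (s n)" "\<And>n. step (s n) (s (Suc n))" by blast
  show ?thesis
    by (rule that[of "\<lambda>n. fst (s n)" "\<lambda>n. fst (snd (s n))" "\<lambda>n. snd (snd (s n))"])
       (use s in \<open>simp_all add: good_def step_def case_prod_beta\<close>)
qed

section \<open>Sums and products in one color\<close>

theorem corollary1p3:
  fixes m :: nat and c :: "nat \<Rightarrow> 'c"
  assumes "m \<ge> 1"
    and "finite_coloring c"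
  shows "\<exists>A B :: nat set. A \<subseteq> {1..} \<and> infinite A \<and> B \<subseteq> {1..} \<and> finite B \<and> card B = m
           \<and> monochromatic c ((A + B) \<union> (A * B))"
proof -
  obtain S P t where PS: "\<And>n. piecewise_syndetic (S n)" and S1: "\<And>n. S n \<subseteq> {1..}"
    and P1: "\<And>n. P n \<ge> 1" and t: "\<And>n. t n \<in> c ` {1..}"
    and ct: "\<And>n x. x \<in> S n \<Longrightarrow> c x = t n"
    and succ: "\<And>n. \<exists>y\<ge>2. P (Suc n) = y * P n \<and>
        S (Suc n) \<subseteq> (*) y ` {x \<in> S n. \<forall>f\<le>(P n)\<^sup>2. x + f * y \<in> S n}"
    by (rule nested_sequence_exists[OF assms(2)]) (rule that)
  have mono: "strict_mono P"
  proof (subst strict_mono_Suc_iff, rule allI)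
    fix n
    obtain y where y: "y \<ge> 2" "P (Suc n) = y * P n" using succ by blast
    have "2 * P n \<le> P (Suc n)" using y by simp
    then show "P n < P (Suc n)" using P1[of n] by linarith
  qed
  have dvd: "P i dvd P j" if "i \<le> j" for i j
    using that
  proof (induction j rule: dec_induct)
    case (step j)
    then show ?case using succ[of j] by (metis dvd_mult)
  qed simp
  \<comment> \<open>Each level down removes one factor \<open>y\<close>; together these factors
    multiply to \<open>P j div P i\<close>.\<close>
  have descent: "\<exists>x\<in>S i. z = P j div P i * x" if "i \<le> j" "z \<in> S j" for i j z
    using that
  proof (induction j arbitrary: z rule: dec_induct)
    case base
    then show ?case using P1[of i] by auto
  next
    case (step j)
    obtain y where y: "P (Suc j) = y * P j"
        "S (Suc j) \<subseteq> (*) y ` {x \<in> S j. \<forall>f\<le>(P j)\<^sup>2. x + f * y \<in> S j}"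
      using succ[of j] by blast
    then obtain x' where x': "z = y * x'" "x' \<in> S j" using step.prems by blast
    then obtain x where "x \<in> S i" "x' = P j div P i * x" using step.IH by blast
    moreover have "P (Suc j) div P i = y * (P j div P i)"
      using dvd[OF step.hyps(1)] y(1) by (simp add: div_mult_swap)
    ultimately show ?case using x'(1) by (metis mult.assoc)
  qed
  \<comment> \<open>The shift happens at the level \<open>j'\<close> just below \<open>j\<close>:
    with \<open>q = P j' div P i\<close>, it puts \<open>q * x + q\<^sup>2 * y\<close> into
    \<open>S j'\<close>. Descent to \<open>i\<close> divides by \<open>q\<close> and leaves
    \<open>x + y * q\<close>, where \<open>y * q\<close> is \<open>P j div P i\<close>.\<close>
  have sum_mem: "x + P j div P i \<in> S i" if "i < j" and mem: "P j div P i * x \<in> S j" for i j x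
  proof -
    obtain j' where j': "j = Suc j'" "i \<le> j'" using \<open>i < j\<close> by (cases j) auto
    obtain y where y: "y \<ge> 2" "P j = y * P j'"
        "S j \<subseteq> (*) y ` {x \<in> S j'. \<forall>f\<le>(P j')\<^sup>2. x + f * y \<in> S j'}"
      using succ[of j'] j'(1) by blast
    define q where "q = P j' div P i"
    have q: "P j div P i = y * q"
      using dvd[OF j'(2)] y(2) by (simp add: q_def div_mult_swap)
    have "q \<ge> 1" using dvd[OF j'(2)] P1[of i] P1[of j'] unfolding q_def
      by (metis div_greater_zero_iff dvd_imp_le less_eq_Suc_le One_nat_def)
    obtain x' where x': "y * (q * x) = y * x'" "\<forall>f\<le>(P j')\<^sup>2. x' + f * y \<in> S j'"
      using mem y(3) unfolding q by (auto simp: mult.assoc)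
    have "x' = q * x" using x'(1) y(1) by simp
    moreover have "q\<^sup>2 \<le> (P j')\<^sup>2" by (simp add: q_def power_mono)
    ultimately have "q * x + q\<^sup>2 * y \<in> S j'" using x'(2) by blast
    then obtain u where u: "u \<in> S i" "q * x + q\<^sup>2 * y = q * u"
      using descent[OF j'(2)] unfolding q_def by blast
    have "q * u = q * (x + y * q)" using u(2) by (simp add: power2_eq_square algebra_simps)
    then have "u = x + y * q" using \<open>q \<ge> 1\<close> by simp
    with u(1) q show ?thesis by simp
  qed
  have "finite (range t)"
    using t assms(2) unfolding finite_coloring_def by (meson finite_subset image_subsetI)
  then obtain i0 where "infinite {n. t n = t i0}"
    using pigeonhole_infinite[of UNIV t] by auto
  \<comment> \<open>Indices up to \<open>i0\<close> are discarded because \<open>sum_mem\<close>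
    needs a strictly higher level.\<close>
  then have "infinite ({n. t n = t i0} - {..i0})" by simp
  then obtain K where K: "K \<subseteq> {n. t n = t i0} - {..i0}" "finite K" "card K = m"
    using infinite_arbitrarily_large by blast
  have "K \<noteq> {}" using K assms(1) by auto
  define M where "M = Max K"
  have M: "M \<in> K" "\<And>k. k \<in> K \<Longrightarrow> k \<le> M" using K(2) \<open>K \<noteq> {}\<close> by (auto simp: M_def)
  have K': "i0 < k" "t k = t i0" if "k \<in> K" for k using K(1) that by auto
  define q where "q k = P k div P i0" for k
  have Pq: "P k = q k * P i0" if "k \<in> K" for k
    using dvd[of i0 k] K'[OF that] by (simp add: q_def)
  \<comment> \<open>Membership is imposed at the top level \<open>M\<close> only;
    \<open>descent\<close> carries it to every \<open>k\<close> in \<open>K\<close>.\<close>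
  define A where "A = {x \<in> S i0. q M * x \<in> S M}"
  define B where "B = q ` K"
  have "S M \<subseteq> (*) (q M) ` A"
  proof
    fix z assume "z \<in> S M"
    with descent[of i0 M z] K'[OF M(1)] show "z \<in> (*) (q M) ` A"
      by (auto simp: A_def q_def)
  qed
  then have "infinite A"
    using piecewise_syndetic_imp_infinite[OF PS[of M]] by (meson finite_imageI finite_subset)
  moreover have "A \<subseteq> {1..}" using S1 by (auto simp: A_def)
  moreover have "B \<subseteq> {1..}"
  proof -
    have "q k \<ge> 1" if "k \<in> K" for k using Pq[OF that] P1[of k] by (cases "q k") auto
    then show ?thesis by (auto simp: B_def)
  qed
  \<comment> \<open>Distinct indices give distinct quotients since \<open>P\<close> is strictly
    increasing.\<close>
  moreover have "inj_on q K"
    using Pq strict_mono_eq[OF mono] by (metis inj_onI)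
  then have "card B = m" using K(3) by (simp add: B_def card_image)
  moreover have "finite B" using K(2) by (simp add: B_def)
  moreover have "c (x + q k) = t i0 \<and> c (x * q k) = t i0" if x: "x \<in> A" and k: "k \<in> K" for x k
  proof -
    \<comment> \<open>Going from \<open>M\<close> down to \<open>k\<close> leaves
      \<open>u = q k * x\<close>. The product thus lies in \<open>S k\<close> and the sum in
      \<open>S i0\<close>, two sets of the same color.\<close>
    obtain u where u: "u \<in> S k" "q M * x = P M div P k * u"
      using descent[OF M(2)[OF k]] x by (auto simp: A_def)
    have "P M = P M div P k * P k" using dvd[OF M(2)[OF k]] by simp
    then have "q M * P i0 = P M div P k * q k * P i0"
      using Pq[OF M(1)] Pq[OF k] by (metis mult.assoc)
    then have qM: "q M = P M div P k * q k" using P1[of i0] by simp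
    have "P M div P k > 0" using qM Pq[OF M(1)] P1[of M] by (cases "P M div P k") auto
    then have "u = q k * x" using u(2) qM by simp
    then have "q k * x \<in> S k" using u(1) by simp
    moreover from this have "x + q k \<in> S i0"
      using sum_mem[of i0 k x] K'[OF k] by (simp add: q_def)
    ultimately show ?thesis using ct K'[OF k] by (metis mult.commute)
  qed
  then have "\<forall>z\<in>(A + B) \<union> (A * B). c z = t i0"
    by (auto simp: B_def elim!: set_plus_elim set_times_elim)
  then have "monochromatic c ((A + B) \<union> (A * B))" by (simp add: monochromatic_def)
  ultimately show ?thesis by blast
qed

end
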